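(* Let $L$ be a frame and let $X$ be its Priestley space of prime filters. Then $L$ is both subfit and Hausdorff if and only if $\mathrm{cl}(\mathrm{haus}_{\mathrm{sfit}}\, U) = U$ for each clopen upset $U$ of $X$.
   Context: A frame is a complete lattice satisfying $a \wedge \bigvee S = \bigvee\{a \wedge s \mid s \in S\}$. The Priestley space of a frame $L$ is the set $X$ of (proper) prime filters of $L$ ordered by inclusion, with topology generated by the basis $\{\sigma(a) \cap \sigma(b)^c \mid a,b \in L\}$, where $\sigma(a) = \{x \in X \mid a \in x\}$. The axiom of choice is assumed. $\mathrm{cl}$ is topological closure in $X$; $U^c = X \setminus U$; $\max S$ is the set of maximal elements of $S \subseteq X$; $\uparrow x = \{y \in X \mid x \le y\}$ and $\downarrow x = \{y \in X \mid y \le x\}$. A frame $L$ is subfit if for all $a,b\in L$ with $a \nleq b$ there is $c \in L$ with $a \vee c = 1$ and $b \vee c \neq 1$. For $c\in L$, $c^*$ denotes the pseudocomplement of $c$. A frame $L$ is Hausdorff (in the sense of Johnstone and Sun) if for all $a,b \in L$ with $a \neq 1$ and $a \nleq b$ there is $c \in L$ with $c \nleq a$ and $c^* \nleq b$. For a clopen upset $U$ of $X$, $$\mathrm{haus}_{\mathrm{sfit}}\, U = \{x \in U \mid \downarrow x \subseteq U \text{ and } (U \neq X \Rightarrow \exists y \in \max(U^c) : \uparrow y \cap \uparrow x = \varnothing)\}.$$ *)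

theory Defs
  imports "HOL-Analysis.Abstract_Topology"
begin

(* The library class complete_distrib_lattice demands complete distributivity, which is
   strictly stronger than the frame law. *)
class frame = complete_lattice +
  assumes inf_Sup_frame: "inf a (Sup S) = Sup {inf a s | s. s \<in> S}"

definition pseudocomplement :: "'a::frame \<Rightarrow> 'a" where
  "pseudocomplement c = Sup {d. inf c d = bot}"

lemma le_pseudocomplement_iff: "d \<le> pseudocomplement c \<longleftrightarrow> inf c d = bot"
proof
  assume "d \<le> pseudocomplement c"
  then have "inf c d \<le> inf c (pseudocomplement c)"
    by (rule inf_mono[OF order_refl])
  also have "\<dots> = Sup {inf c s | s. s \<in> {d. inf c d = bot}}"
    unfolding pseudocomplement_def by (rule inf_Sup_frame)
  also have "\<dots> \<le> bot"
    by (rule Sup_least) auto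
  finally show "inf c d = bot"
    by (simp add: bot_unique)
next
  assume "inf c d = bot"
  then show "d \<le> pseudocomplement c"
    unfolding pseudocomplement_def by (intro Sup_upper) simp
qed

(* Properties of the frame L as a whole are predicates on the type 'a carrying L. *)
definition subfit :: "'a::frame itself \<Rightarrow> bool" where
  "subfit _ \<longleftrightarrow>
    (\<forall>a b :: 'a. \<not> a \<le> b \<longrightarrow> (\<exists>c. sup a c = top \<and> sup b c \<noteq> top))"

definition hausdorff_frame :: "'a::frame itself \<Rightarrow> bool" where
  "hausdorff_frame _ \<longleftrightarrow>
    (\<forall>a b :: 'a. a \<noteq> top \<and> \<not> a \<le> b \<longrightarrow>
      (\<exists>c. \<not> c \<le> a \<and> \<not> pseudocomplement c \<le> b))"

definition prime_filter :: "'a::frame set \<Rightarrow> bool" where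
  "prime_filter F \<longleftrightarrow>
    F \<noteq> {} \<and> F \<noteq> UNIV \<and>
    (\<forall>a b. a \<in> F \<and> a \<le> b \<longrightarrow> b \<in> F) \<and>
    (\<forall>a b. a \<in> F \<and> b \<in> F \<longrightarrow> inf a b \<in> F) \<and>
    (\<forall>a b. sup a b \<in> F \<longrightarrow> a \<in> F \<or> b \<in> F)"

abbreviation prime_filters :: "'a::frame set set" where
  "prime_filters \<equiv> {x. prime_filter x}"

definition sigma :: "'a::frame \<Rightarrow> 'a set set" where
  "sigma a = {x \<in> prime_filters. a \<in> x}"

definition priestley_space :: "'a::frame set topology" where
  "priestley_space =
    topology_generated_by {sigma a \<inter> (prime_filters - sigma b) | a b. True}"

lemma topspace_priestley_space: "topspace priestley_space = prime_filters"
proof -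
  have "sigma top \<inter> (prime_filters - sigma bot) = (prime_filters :: 'a set set)"
  proof (intro equalityI subsetI)
    fix x :: "'a set" assume "x \<in> prime_filters"
    then have x: "prime_filter x" by simp
    then obtain a where "a \<in> x" unfolding prime_filter_def by (auto simp del: all_not_in_conv)
    with x have "top \<in> x" unfolding prime_filter_def by (meson top_greatest)
    moreover have "bot \<notin> x"
    proof
      assume "bot \<in> x"
      with x have "b \<in> x" for b unfolding prime_filter_def by (meson bot_least)
      with x show False unfolding prime_filter_def by auto
    qed
    ultimately show "x \<in> sigma top \<inter> (prime_filters - sigma bot)"
      using x by (simp add: sigma_def)
  qed simp
  then have "prime_filters \<in> {sigma a \<inter> (prime_filters - sigma b) | a b :: 'a. True}"
    by (metis (mono_tags, lifting) mem_Collect_eq)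
  then have "\<Union> {sigma a \<inter> (prime_filters - sigma b) | a b :: 'a. True} = prime_filters"
    by (intro equalityI Union_upper Union_least) auto
  then show ?thesis
    unfolding priestley_space_def topology_generated_by_topspace .
qed

(* The order on the Priestley space is inclusion of prime filters. *)
definition up :: "'a::frame set \<Rightarrow> 'a set set" where
  "up x = {y \<in> prime_filters. x \<subseteq> y}"

definition down :: "'a::frame set \<Rightarrow> 'a set set" where
  "down x = {y \<in> prime_filters. y \<subseteq> x}"

definition max_points :: "'a::frame set set \<Rightarrow> 'a set set" where
  "max_points S = {x \<in> S. \<forall>y\<in>S. x \<subseteq> y \<longrightarrow> y = x}"

definition clopen_upset :: "'a::frame set set \<Rightarrow> bool" where
  "clopen_upset U \<longleftrightarrow>
    openin priestley_space U \<and> closedin priestley_space U \<and> (\<forall>x\<in>U. up x \<subseteq> U)"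

definition haus_sfit :: "'a::frame set set \<Rightarrow> 'a set set" where
  "haus_sfit U =
    {x \<in> U. down x \<subseteq> U \<and>
      (U \<noteq> prime_filters \<longrightarrow> (\<exists>y \<in> max_points (prime_filters - U). up y \<inter> up x = {}))}"

end

theory Submission
  imports Defs
begin

text \<open>
  Both frame conditions provide, for pairs \<open>a \<not>\<le> b\<close>, an element \<open>c\<close> with certain properties;
  the prime filter theorem turns such elements into points of the Priestley space and back.
  Throughout, clopen upsets are the sets \<open>sigma a\<close>, and a prime filter \<open>x\<close> lies in the closure
  of \<open>S\<close> iff for every \<open>f \<in> x\<close> and \<open>j \<notin> x\<close> some point of \<open>S\<close> contains \<open>f\<close> and omits \<open>j\<close>.

  Suppose that the frame is subfit and Hausdorff, and let \<open>sigma f - sigma j\<close> be a basic open set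
  that meets \<open>sigma a\<close>, so that \<open>inf a f \<not>\<le> j\<close>. If \<open>a = top\<close>, every point belongs to
  \<open>haus_sfit (sigma a)\<close>. Otherwise, the Hausdorff condition is applied to \<open>a\<close> and the relative
  pseudocomplement \<open>inf a f \<rightarrow> j\<close> instead of \<open>a\<close> and \<open>j\<close>: this yields \<open>c\<close> with \<open>c \<not>\<le> a\<close> and
  \<open>inf c* (inf a f) \<not>\<le> j\<close>. Subfitness of the latter pair gives a point \<open>x\<close> outside \<open>sigma j\<close>
  all of whose predecessors contain \<open>a\<close>, \<open>f\<close> and \<open>c*\<close>, while \<open>c \<not>\<le> a\<close> gives a prime filter
  \<open>y\<close> containing \<open>c\<close> that is maximal among those without \<open>a\<close>. Since no proper filter contains
  both \<open>c\<close> and \<open>c*\<close>, \<open>x\<close> and \<open>y\<close> have no common upper bound, so that \<open>x\<close> is a point of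
  \<open>haus_sfit (sigma a)\<close> in the given basic open set.

  Conversely, if \<open>a \<not>\<le> b\<close> then density provides a point \<open>x\<close> of \<open>haus_sfit (sigma a)\<close> without \<open>b\<close>
  and, if \<open>a \<noteq> top\<close>, a maximal point \<open>y\<close> outside \<open>sigma a\<close> that has no upper bound in common with
  \<open>x\<close>. That \<open>down x \<subseteq> sigma a\<close> means \<open>sup a c = top\<close> for some \<open>c \<notin> x\<close>, and this \<open>c\<close> witnesses
  subfitness. That \<open>x\<close> and \<open>y\<close> have no common upper bound means \<open>inf c d = bot\<close> for some \<open>c \<in> y\<close>
  and \<open>d \<in> x\<close>, and this \<open>c\<close> witnesses the Hausdorff condition, as \<open>a \<notin> y\<close> and \<open>b \<notin> x\<close>.

  The two consequences of the axiom of choice needed here, the prime filter theorem and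
  compactness of the Priestley space, are both instances of the single lemma
  \<open>separation_extends_to_prime_filter\<close>.
\<close>

section \<open>Distributivity and relative pseudocomplements in frames\<close>

lemma inf_sup_frame: "inf a (sup b c) = sup (inf a b) (inf a c)" for a :: "'a::frame"
proof -
  have "inf a (Sup {b, c}) = Sup {inf a s | s. s \<in> {b, c}}"
    by (rule inf_Sup_frame)
  also have "{inf a s | s. s \<in> {b, c}} = {inf a b, inf a c}"
    by auto
  finally show ?thesis by simp
qed

text \<open>
  The lattice form of the cut rule, which is where distributivity enters the prime filter theorem.
\<close>

lemma cut_le:
  fixes f i c :: "'a::frame"
  assumes "inf f c \<le> i" "f \<le> sup i c"
  shows "f \<le> i"
proof -
  have "f = inf f (sup i c)"
    using assms(2) by (simp add: inf.absorb1)
  also have "\<dots> = sup (inf f i) (inf f c)"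
    by (rule inf_sup_frame)
  also have "\<dots> \<le> i"
    using assms(1) by simp
  finally show ?thesis .
qed

lemma relative_pseudocomplement_exists:
  fixes e b :: "'a::frame"
  obtains h where "\<And>s. s \<le> h \<longleftrightarrow> inf e s \<le> b"
proof
  fix s
  let ?h = "Sup {s. inf e s \<le> b}"
  have "inf e ?h \<le> b"
    unfolding inf_Sup_frame by (rule Sup_least) auto
  moreover have "inf e s \<le> inf e ?h" if "s \<le> ?h"
    using that by (rule inf_mono[OF order_refl])
  moreover have "s \<le> ?h" if "inf e s \<le> b"
    using that by (intro Sup_upper) simp
  ultimately show "s \<le> ?h \<longleftrightarrow> inf e s \<le> b"
    using order_trans by blast
qed

section \<open>Prime filters from separation relations\<close>

definition lattice_filter :: "'a::frame set \<Rightarrow> bool" where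
  "lattice_filter F \<longleftrightarrow> top \<in> F \<and> (\<forall>a b. a \<in> F \<and> a \<le> b \<longrightarrow> b \<in> F) \<and>
    (\<forall>a b. a \<in> F \<and> b \<in> F \<longrightarrow> inf a b \<in> F)"

definition lattice_ideal :: "'a::frame set \<Rightarrow> bool" where
  "lattice_ideal I \<longleftrightarrow> bot \<in> I \<and> (\<forall>a b. b \<in> I \<and> a \<le> b \<longrightarrow> a \<in> I) \<and>
    (\<forall>a b. a \<in> I \<and> b \<in> I \<longrightarrow> sup a b \<in> I)"

lemma lattice_filter_principal: "lattice_filter {a..}"
  by (auto simp: lattice_filter_def intro: order_trans)

lemma lattice_ideal_principal: "lattice_ideal {..a}"
  by (auto simp: lattice_ideal_def intro: order_trans)

lemma prime_filter_lattice_filter: "prime_filter x \<Longrightarrow> lattice_filter x"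
  unfolding prime_filter_def lattice_filter_def by (metis ex_in_conv top_greatest)

lemma prime_filter_bot: "prime_filter x \<Longrightarrow> bot \<notin> x"
  unfolding prime_filter_def by (metis UNIV_eq_I bot_least)

lemma prime_filter_top: "prime_filter x \<Longrightarrow> top \<in> x"
  using prime_filter_lattice_filter by (auto simp: lattice_filter_def)

lemma prime_filter_mono: "prime_filter x \<Longrightarrow> a \<in> x \<Longrightarrow> a \<le> b \<Longrightarrow> b \<in> x"
  unfolding prime_filter_def by blast

lemma prime_filter_inf_iff: "prime_filter x \<Longrightarrow> inf a b \<in> x \<longleftrightarrow> a \<in> x \<and> b \<in> x"
  unfolding prime_filter_def by (meson inf_le1 inf_le2)

lemma prime_filter_sup_iff: "prime_filter x \<Longrightarrow> sup a b \<in> x \<longleftrightarrow> a \<in> x \<or> b \<in> x"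
  unfolding prime_filter_def by (meson sup_ge1 sup_ge2)

text \<open>
  Read \<open>M f i\<close> as: some admissible prime filter contains \<open>f\<close> and omits \<open>i\<close>. Such a filter either
  contains or omits any further element \<open>c\<close>, whence the cut condition. The two instances of
  interest are \<open>\<not> f \<le> i\<close> and the statement that a fixed set of prime filters meets
  \<open>sigma f - sigma i\<close>.
\<close>

definition separation_relation :: "('a::frame \<Rightarrow> 'a \<Rightarrow> bool) \<Rightarrow> bool" where
  "separation_relation M \<longleftrightarrow>
    (\<forall>f i. M f i \<longrightarrow> \<not> f \<le> i) \<and>
    (\<forall>f f' i i'. M f i \<and> f \<le> f' \<and> i' \<le> i \<longrightarrow> M f' i') \<and>
    (\<forall>f i c. M f i \<longrightarrow> M (inf f c) i \<or> M f (sup i c))"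

lemma separation_relation_not_le: "separation_relation (\<lambda>f i :: 'a::frame. \<not> f \<le> i)"
  unfolding separation_relation_def by (meson cut_le order_trans)

lemma separation_relation_points:
  assumes "K \<subseteq> prime_filters"
  shows "separation_relation (\<lambda>f i. \<exists>z\<in>K. f \<in> z \<and> i \<notin> z)"
  unfolding separation_relation_def
proof (intro conjI allI impI)
  fix f i c
  assume "\<exists>z\<in>K. f \<in> z \<and> i \<notin> z"
  then show "(\<exists>z\<in>K. inf f c \<in> z \<and> i \<notin> z) \<or> (\<exists>z\<in>K. f \<in> z \<and> sup i c \<notin> z)"
    using assms by (metis mem_Collect_eq prime_filter_inf_iff prime_filter_sup_iff subsetD)
next
  fix f i
  assume "\<exists>z\<in>K. f \<in> z \<and> i \<notin> z"
  then show "\<not> f \<le> i"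
    using assms by (metis mem_Collect_eq prime_filter_mono subsetD)
next
  fix f f' i i'
  assume "(\<exists>z\<in>K. f \<in> z \<and> i \<notin> z) \<and> f \<le> f' \<and> i' \<le> i"
  then show "\<exists>z\<in>K. f' \<in> z \<and> i' \<notin> z"
    using assms by (metis mem_Collect_eq prime_filter_mono subsetD)
qed

text \<open>
  Zorn's lemma gives a filter \<open>y\<close> that is maximal with respect to being \<open>M\<close>-related to all of \<open>I\<close>.
  If \<open>c \<notin> y\<close>, maximality forces \<open>\<not> M (inf f c) i\<close> for some \<open>f \<in> y\<close> and \<open>i \<in> I\<close>; the cut
  condition then moves \<open>c\<close> to the other side. This makes \<open>y\<close> prime and, more strongly, extends \<open>M\<close>
  to all of \<open>y\<close> and its complement.
\<close>

lemma separation_extends_to_prime_filter: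
  fixes M :: "'a::frame \<Rightarrow> 'a \<Rightarrow> bool"
  assumes M: "separation_relation M"
    and F: "lattice_filter F" and I: "lattice_ideal I"
    and FI: "\<And>f i. f \<in> F \<Longrightarrow> i \<in> I \<Longrightarrow> M f i"
  obtains y where "prime_filter y" "F \<subseteq> y" "y \<inter> I = {}"
    "\<And>f j. f \<in> y \<Longrightarrow> j \<notin> y \<Longrightarrow> M f j"
    "\<And>G. lattice_filter G \<Longrightarrow> y \<subseteq> G \<Longrightarrow> (\<And>g i. g \<in> G \<Longrightarrow> i \<in> I \<Longrightarrow> M g i) \<Longrightarrow> G = y"
proof -
  have M_irrefl: "\<not> f \<le> i" if "M f i" for f i
    using M that unfolding separation_relation_def by blast
  have M_mono: "M f' i'" if "M f i" "f \<le> f'" "i' \<le> i" for f f' i i'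
    using M that unfolding separation_relation_def by blast
  have M_cut: "M (inf f c) i \<or> M f (sup i c)" if "M f i" for f i c
    using M that unfolding separation_relation_def by blast
  define A where "A = {G. lattice_filter G \<and> F \<subseteq> G \<and> (\<forall>g\<in>G. \<forall>i\<in>I. M g i)}"
  have "\<exists>y\<in>A. \<forall>G\<in>A. y \<subseteq> G \<longrightarrow> G = y"
  proof (rule subset_Zorn_nonempty)
    show "A \<noteq> {}"
      using F FI unfolding A_def by blast
  next
    fix C assume C: "C \<noteq> {}" "subset.chain A C"
    then have CA: "C \<subseteq> A" and chain: "\<And>G H. G \<in> C \<Longrightarrow> H \<in> C \<Longrightarrow> G \<subseteq> H \<or> H \<subseteq> G"
      unfolding subset.chain_def by auto
    have filt: "lattice_filter G" if "G \<in> C" for G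
      using CA that unfolding A_def by blast
    have "lattice_filter (\<Union>C)"
      unfolding lattice_filter_def
    proof (intro conjI allI impI)
      show "top \<in> \<Union>C"
        using C(1) filt unfolding lattice_filter_def by blast
    next
      fix a b assume "a \<in> \<Union>C \<and> a \<le> b"
      then show "b \<in> \<Union>C"
        using filt unfolding lattice_filter_def by blast
    next
      fix a b assume "a \<in> \<Union>C \<and> b \<in> \<Union>C"
      then obtain G H where "a \<in> G" "b \<in> H" "G \<in> C" "H \<in> C" by blast
      then obtain K where "a \<in> K" "b \<in> K" "K \<in> C"
        using chain[of G H] by blast
      then show "inf a b \<in> \<Union>C"
        using filt unfolding lattice_filter_def by blast
    qed
    then show "\<Union>C \<in> A"
      using C(1) CA unfolding A_def by blast
  qed
  then obtain y where "y \<in> A" and max: "\<And>G. G \<in> A \<Longrightarrow> y \<subseteq> G \<Longrightarrow> G = y"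
    by blast
  then have y: "lattice_filter y" and Fy: "F \<subseteq> y" and yI: "\<And>g i. g \<in> y \<Longrightarrow> i \<in> I \<Longrightarrow> M g i"
    unfolding A_def by blast+
  have y_inf: "\<And>a b. a \<in> y \<Longrightarrow> b \<in> y \<Longrightarrow> inf a b \<in> y"
    using y unfolding lattice_filter_def by blast
  have I_bot: "bot \<in> I" and I_sup: "\<And>i j. i \<in> I \<Longrightarrow> j \<in> I \<Longrightarrow> sup i j \<in> I"
    using I unfolding lattice_ideal_def by blast+
  have disj: "y \<inter> I = {}"
    using yI M_irrefl by blast
  have obstruction: "\<exists>f\<in>y. \<exists>i\<in>I. \<not> M (inf f c) i" if "c \<notin> y" for c
  proof (rule ccontr)
    assume *: "\<not> (\<exists>f\<in>y. \<exists>i\<in>I. \<not> M (inf f c) i)"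
    \<comment> \<open>the filter generated by \<open>y\<close> and \<open>c\<close>\<close>
    let ?G = "{g. \<exists>f\<in>y. inf f c \<le> g}"
    have "top \<in> ?G"
      using y unfolding lattice_filter_def by (auto intro!: bexI[of _ top])
    moreover have "inf a b \<in> ?G" if ab: "a \<in> ?G" "b \<in> ?G" for a b
    proof -
      obtain f g where "f \<in> y" "g \<in> y" "inf f c \<le> a" "inf g c \<le> b"
        using ab by blast
      moreover from this have "inf (inf f g) c \<le> inf a b"
        by (meson inf.boundedI inf_le1 inf_le2 inf_mono order_refl order_trans)
      ultimately show ?thesis
        using y_inf by blast
    qed
    ultimately have "lattice_filter ?G"
      unfolding lattice_filter_def by (blast intro: order_trans)
    moreover have "y \<subseteq> ?G"
      using inf_le1 by blast
    moreover have "M g i" if "g \<in> ?G" "i \<in> I" for g i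
      using * M_mono[OF _ _ order_refl] that by blast
    ultimately have "?G = y"
      using Fy by (intro max) (auto simp: A_def)
    moreover have "c \<in> ?G"
      using \<open>top \<in> ?G\<close> by (auto intro: inf_le2)
    ultimately show False
      using that by blast
  qed
  have "c \<in> y \<or> d \<in> y" if cd: "sup c d \<in> y" for c d
  proof (rule ccontr)
    assume "\<not> (c \<in> y \<or> d \<in> y)"
    then obtain f i g j where f: "f \<in> y" "i \<in> I" "\<not> M (inf f c) i"
      and g: "g \<in> y" "j \<in> I" "\<not> M (inf g d) j"
      using obstruction by meson
    let ?f = "inf (inf f g) (sup c d)" and ?i = "sup i j"
    have "M ?f ?i"
      using f g cd by (intro yI y_inf I_sup)
    then consider "M (inf ?f c) ?i" | "M (inf ?f d) (sup ?i c)" | "M ?f (sup (sup ?i c) d)"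
      using M_cut by blast
    then show False
    proof cases
      case 1
      then have "M (inf f c) i"
        by (rule M_mono) (auto intro: le_infI1)
      with f show False by blast
    next
      case 2
      then have "M (inf g d) j"
        by (rule M_mono) (auto intro: le_infI1 le_infI2 le_supI1)
      with g show False by blast
    next
      case 3
      moreover have "?f \<le> sup (sup ?i c) d"
        unfolding sup_assoc[of ?i] by (intro le_infI2 sup_ge2)
      ultimately show False
        using M_irrefl by blast
    qed
  qed
  with y disj I_bot have prime: "prime_filter y"
    unfolding prime_filter_def lattice_filter_def by blast
  have "M f j" if fj: "f \<in> y" "j \<notin> y" for f j
  proof -
    obtain g i where g: "g \<in> y" "i \<in> I" "\<not> M (inf g j) i"
      using obstruction fj by blast
    have "M (inf f g) i"
      using fj g by (intro yI y_inf)
    then consider "M (inf (inf f g) j) i" | "M (inf f g) (sup i j)"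
      using M_cut by blast
    then show ?thesis
    proof cases
      case 1
      then have "M (inf g j) i"
        by (rule M_mono) (auto intro: le_infI1)
      with g show ?thesis by blast
    next
      case 2
      then show ?thesis
        by (rule M_mono) auto
    qed
  qed
  moreover have "G = y" if "lattice_filter G" "y \<subseteq> G" "\<And>g i. g \<in> G \<Longrightarrow> i \<in> I \<Longrightarrow> M g i" for G
    using that Fy by (intro max) (auto simp: A_def)
  ultimately show thesis
    using that prime Fy disj by blast
qed

lemma maximal_disjoint_filter_prime:
  fixes F I :: "'a::frame set"
  assumes F: "lattice_filter F" and I: "lattice_ideal I" and "F \<inter> I = {}"
  obtains y where "prime_filter y" "F \<subseteq> y" "y \<inter> I = {}"
    "\<And>G. lattice_filter G \<Longrightarrow> y \<subseteq> G \<Longrightarrow> G \<inter> I = {} \<Longrightarrow> G = y"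
proof -
  have rel: "\<not> g \<le> i" if "lattice_filter G" "G \<inter> I = {}" "g \<in> G" "i \<in> I" for G g i
    using that unfolding lattice_filter_def by blast
  obtain y where "prime_filter y" "F \<subseteq> y" "y \<inter> I = {}"
    "\<And>G. lattice_filter G \<Longrightarrow> y \<subseteq> G \<Longrightarrow> (\<And>g i. g \<in> G \<Longrightarrow> i \<in> I \<Longrightarrow> \<not> g \<le> i) \<Longrightarrow> G = y"
    using separation_extends_to_prime_filter[OF separation_relation_not_le F I]
      rel[OF F \<open>F \<inter> I = {}\<close>] by metis
  then show thesis
    using rel by (intro that[of y]) metis+
qed

lemma disjoint_prime_filter_exists:
  assumes "lattice_filter F" "lattice_ideal I" "F \<inter> I = {}"
  obtains y where "prime_filter y" "F \<subseteq> y" "y \<inter> I = {}"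
  by (rule maximal_disjoint_filter_prime[OF assms]) (rule that)

text \<open>
  A filter maximal among those disjoint from \<open>{..b}\<close> is in particular maximal among the prime
  filters without \<open>b\<close>, the kind of point that \<open>haus_sfit\<close> asks for.
\<close>

lemma prime_filter_separates:
  fixes a b :: "'a::frame"
  assumes "\<not> a \<le> b"
  obtains y where "prime_filter y" "a \<in> y" "b \<notin> y"
    "y \<in> max_points (prime_filters - sigma b)"
proof -
  have "{a..} \<inter> {..b} = {}"
    using assms by (auto dest: order_trans)
  then obtain y where y: "prime_filter y" "{a..} \<subseteq> y" "y \<inter> {..b} = {}"
    and max: "\<And>G. lattice_filter G \<Longrightarrow> y \<subseteq> G \<Longrightarrow> G \<inter> {..b} = {} \<Longrightarrow> G = y"
    using maximal_disjoint_filter_prime[OF lattice_filter_principal lattice_ideal_principal]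
    by metis
  have "z \<inter> {..b} = {}" if "prime_filter z" "b \<notin> z" for z
    using that prime_filter_mono by fastforce
  then have "z = y" if "prime_filter z" "b \<notin> z" "y \<subseteq> z" for z
    using that by (intro max prime_filter_lattice_filter)
  then have "y \<in> max_points (prime_filters - sigma b)"
    using y unfolding max_points_def sigma_def by auto
  with y show thesis
    by (intro that[of y]) auto
qed

section \<open>The topology of the Priestley space\<close>

text \<open>
  The generating sets of the topology form a basis, because
  \<open>sigma f - sigma j\<close> and \<open>sigma g - sigma k\<close> intersect in \<open>sigma (inf f g) - sigma (sup j k)\<close>.
\<close>

lemma in_closure_of_priestley_iff:
  "x \<in> priestley_space closure_of S \<longleftrightarrow>
    prime_filter x \<and> (\<forall>f j. f \<in> x \<and> j \<notin> x \<longrightarrow> (\<exists>z\<in>S. prime_filter z \<and> f \<in> z \<and> j \<notin> z))"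
proof -
  let ?B = "{sigma a \<inter> (prime_filters - sigma b) | a b. True}"
  have basic: "\<exists>f j. f \<in> x \<and> j \<notin> x \<and> sigma f \<inter> (prime_filters - sigma j) \<subseteq> V"
    if "openin priestley_space V" "x \<in> V" for V and x :: "'a set"
  proof -
    have "generate_topology_on ?B V"
      using that(1) unfolding priestley_space_def openin_topology_generated_by_iff .
    then show ?thesis
      using that(2)
    proof (induction V)
      case (Int V W)
      then obtain f j g k where *: "f \<in> x" "j \<notin> x" "sigma f \<inter> (prime_filters - sigma j) \<subseteq> V"
        "g \<in> x" "k \<notin> x" "sigma g \<inter> (prime_filters - sigma k) \<subseteq> W"
        by blast
      have "openin priestley_space (V \<inter> W)"
        unfolding priestley_space_def openin_topology_generated_by_iff
        using Int.hyps by (rule generate_topology_on.Int)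
      then have x: "prime_filter x"
        using Int.prems openin_subset topspace_priestley_space by blast
      have "sigma (inf f g) \<inter> (prime_filters - sigma (sup j k)) \<subseteq> V \<inter> W"
        using *(3,6) by (auto simp: sigma_def prime_filter_inf_iff prime_filter_sup_iff)
      then show ?case
        using * x prime_filter_inf_iff prime_filter_sup_iff by metis
    next
      case (UN K)
      then show ?case by (meson Union_iff Union_upper order_trans)
    next
      case (Basis s)
      then show ?case unfolding sigma_def by blast
    qed simp
  qed
  have opn: "openin priestley_space (sigma f \<inter> (prime_filters - sigma j))" for f j :: 'a
    unfolding priestley_space_def by (rule topology_generated_by_Basis) blast
  show ?thesis
  proof (intro iffI conjI allI impI)
    assume x: "x \<in> priestley_space closure_of S"
    then show p: "prime_filter x"
      by (auto simp: in_closure_of topspace_priestley_space)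
    fix f j assume "f \<in> x \<and> j \<notin> x"
    with p have "x \<in> sigma f \<inter> (prime_filters - sigma j)"
      by (simp add: sigma_def)
    with x obtain z where "z \<in> S" "z \<in> sigma f \<inter> (prime_filters - sigma j)"
      unfolding in_closure_of using opn[of f j] by meson
    then show "\<exists>z\<in>S. prime_filter z \<and> f \<in> z \<and> j \<notin> z"
      unfolding sigma_def by blast
  next
    assume *: "prime_filter x \<and> (\<forall>f j. f \<in> x \<and> j \<notin> x \<longrightarrow> (\<exists>z\<in>S. prime_filter z \<and> f \<in> z \<and> j \<notin> z))"
    have "\<exists>z\<in>S. z \<in> V" if V: "x \<in> V" "openin priestley_space V" for V
    proof -
      obtain f j where fj: "f \<in> x" "j \<notin> x" "sigma f \<inter> (prime_filters - sigma j) \<subseteq> V"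
        using basic[OF V(2,1)] by blast
      then obtain z where "z \<in> S" "prime_filter z" "f \<in> z" "j \<notin> z"
        using * by blast
      then show ?thesis
        using fj(3) unfolding sigma_def by blast
    qed
    with * show "x \<in> priestley_space closure_of S"
      unfolding in_closure_of topspace_priestley_space by blast
  qed
qed

text \<open>
  Compactness of the Priestley space in terms of filters and ideals. The prime filter \<open>y\<close> that
  extends \<open>F\<close> still has points of \<open>K\<close> in each of its basic neighbourhoods, so it lies in \<open>K\<close>.
\<close>

lemma closed_set_meets_filter_ideal:
  assumes K: "closedin priestley_space K"
    and F: "lattice_filter F" and I: "lattice_ideal I"
    and FI: "\<And>f i. f \<in> F \<Longrightarrow> i \<in> I \<Longrightarrow> \<exists>z\<in>K. f \<in> z \<and> i \<notin> z"
  obtains y where "y \<in> K" "F \<subseteq> y" "y \<inter> I = {}"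
proof -
  have Kp: "K \<subseteq> prime_filters"
    using closedin_subset[OF K] by (simp add: topspace_priestley_space)
  obtain y where y: "prime_filter y" "F \<subseteq> y" "y \<inter> I = {}"
    "\<And>f j. f \<in> y \<Longrightarrow> j \<notin> y \<Longrightarrow> \<exists>z\<in>K. f \<in> z \<and> j \<notin> z"
    using separation_extends_to_prime_filter[OF separation_relation_points[OF Kp] F I FI] by metis
  then have "y \<in> priestley_space closure_of K"
    using Kp unfolding in_closure_of_priestley_iff by blast
  then have "y \<in> K"
    using closure_of_closedin[OF K] by simp
  with y show thesis
    by (intro that)
qed

lemma clopen_upset_sigma: "clopen_upset (sigma a)"
proof -
  have eq: "prime_filters - (prime_filters - sigma a) = sigma a"
    "sigma a \<inter> (prime_filters - sigma bot) = sigma a"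
    "sigma top \<inter> (prime_filters - sigma a) = prime_filters - sigma a"
    using prime_filter_bot prime_filter_top by (auto simp: sigma_def)
  have opn: "openin priestley_space (sigma f \<inter> (prime_filters - sigma j))" for f j :: 'a
    unfolding priestley_space_def by (rule topology_generated_by_Basis) blast
  have "openin priestley_space (sigma a)"
    using opn[of a bot] by (simp only: eq)
  moreover have "closedin priestley_space (sigma a)"
    using opn[of top a] unfolding closedin_def topspace_priestley_space eq
    by (auto simp: sigma_def)
  ultimately show ?thesis
    unfolding clopen_upset_def by (auto simp: sigma_def up_def)
qed

text \<open>
  Compactness is used twice: for the closed complement of \<open>U\<close>, to cover \<open>U\<close> by sets
  \<open>sigma a \<subseteq> U\<close>, and for \<open>U\<close> itself, to find one such set that is all of \<open>U\<close>.
\<close>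

lemma clopen_upset_eq_sigma:
  assumes "clopen_upset U"
  obtains a where "U = sigma a"
proof -
  have cl: "closedin priestley_space U" "closedin priestley_space (prime_filters - U)"
    and upset: "\<And>x y. x \<in> U \<Longrightarrow> prime_filter y \<Longrightarrow> x \<subseteq> y \<Longrightarrow> y \<in> U"
    using assms openin_closedin_eq[of priestley_space U]
    unfolding clopen_upset_def up_def topspace_priestley_space by blast+
  have Up: "U \<subseteq> prime_filters"
    using closedin_subset[OF cl(1)] by (simp add: topspace_priestley_space)
  define I where "I = {a. sigma a \<subseteq> U}"
  have cover: "x \<inter> I \<noteq> {}" if "x \<in> U" for x
  proof
    assume "x \<inter> I = {}"
    have x: "prime_filter x"
      using that Up by blast
    have "\<exists>z\<in>prime_filters - U. f \<in> z \<and> i \<notin> z" if "f \<in> x" "i \<in> {..bot}" for f i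
    proof -
      have "\<not> sigma f \<subseteq> U"
        using \<open>f \<in> x\<close> \<open>x \<inter> I = {}\<close> unfolding I_def by blast
      then show ?thesis
        using \<open>i \<in> {..bot}\<close> prime_filter_bot by (auto simp: sigma_def bot_unique)
    qed
    then obtain y where "y \<in> prime_filters - U" "x \<subseteq> y"
      using closed_set_meets_filter_ideal[OF cl(2) prime_filter_lattice_filter[OF x]
          lattice_ideal_principal[of bot]] by metis
    with upset[OF that] show False by blast
  qed
  have "lattice_ideal I"
    unfolding lattice_ideal_def I_def sigma_def
    by (auto simp: prime_filter_sup_iff subset_iff prime_filter_bot dest: prime_filter_mono)
  have "\<exists>i\<in>I. U \<subseteq> sigma i"
  proof (rule ccontr)
    assume none: "\<not> (\<exists>i\<in>I. U \<subseteq> sigma i)"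
    have "\<exists>z\<in>U. f \<in> z \<and> i \<notin> z" if "f \<in> {top..}" "i \<in> I" for f i
    proof -
      have "f = top"
        using that(1) by (simp add: top_unique)
      then show ?thesis
        using none Up prime_filter_top \<open>i \<in> I\<close> unfolding sigma_def by blast
    qed
    then obtain y where "y \<in> U" "y \<inter> I = {}"
      using closed_set_meets_filter_ideal[OF cl(1) lattice_filter_principal[of top]
          \<open>lattice_ideal I\<close>] by metis
    with cover show False by blast
  qed
  then show thesis
    using that unfolding I_def by blast
qed

lemma sigma_eq_prime_filters_iff: "sigma a = prime_filters \<longleftrightarrow> a = top"
proof
  assume *: "sigma a = prime_filters"
  show "a = top"
  proof (rule ccontr)
    assume "a \<noteq> top"
    then have "\<not> top \<le> a"
      by (simp add: top_unique)
    then obtain y where "prime_filter y" "a \<notin> y"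
      by (rule prime_filter_separates)
    with * show False
      by (auto simp: sigma_def)
  qed
qed (auto simp: sigma_def prime_filter_top)

section \<open>Translating order conditions on points into the frame\<close>

text \<open>
  If no \<open>c \<notin> x\<close> satisfies \<open>sup a c = top\<close>, then \<open>a\<close> and the complement of \<open>x\<close> generate a proper
  ideal, and a prime filter disjoint from it lies below \<open>x\<close> and omits \<open>a\<close>.
\<close>

lemma down_subset_sigma_iff:
  assumes x: "prime_filter x"
  shows "down x \<subseteq> sigma a \<longleftrightarrow> (\<exists>c. c \<notin> x \<and> sup a c = top)"
proof
  assume "\<exists>c. c \<notin> x \<and> sup a c = top"
  then obtain c where "c \<notin> x" "sup a c = top" by blast
  then show "down x \<subseteq> sigma a"
    using prime_filter_sup_iff[of _ a c] prime_filter_top by (auto simp: down_def sigma_def)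
next
  assume dn: "down x \<subseteq> sigma a"
  show "\<exists>c. c \<notin> x \<and> sup a c = top"
  proof (rule ccontr)
    assume none: "\<not> (\<exists>c. c \<notin> x \<and> sup a c = top)"
    let ?I = "{i. \<exists>c. c \<notin> x \<and> i \<le> sup a c}"
    have "sup i j \<in> ?I" if ij: "i \<in> ?I" "j \<in> ?I" for i j
    proof -
      obtain c d where "c \<notin> x" "d \<notin> x" "i \<le> sup a c" "j \<le> sup a d"
        using ij by blast
      then have "sup c d \<notin> x" "sup i j \<le> sup a (sup c d)"
        using prime_filter_sup_iff[OF x]
        by (auto intro: order_trans[OF _ sup_mono[OF order_refl]])
      then show ?thesis by blast
    qed
    moreover have "bot \<in> ?I"
      using prime_filter_bot[OF x] by auto
    ultimately have "lattice_ideal ?I"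
      unfolding lattice_ideal_def by (blast intro: order_trans)
    moreover have "{top..} \<inter> ?I = {}"
      using none by (auto simp: top_unique)
    ultimately obtain y where y: "prime_filter y" "{top..} \<subseteq> y" "y \<inter> ?I = {}"
      by (rule disjoint_prime_filter_exists[OF lattice_filter_principal])
    have "a \<in> ?I"
      using prime_filter_bot[OF x] by auto
    moreover have "c \<in> ?I" if "c \<notin> x" for c
      using that by (auto intro: sup_ge2)
    ultimately have "y \<subseteq> x" "a \<notin> y"
      using y(3) by blast+
    with y(1) dn show False
      by (auto simp: down_def sigma_def)
  qed
qed

text \<open>
  The elements \<open>inf c d\<close> with \<open>c \<in> y\<close> and \<open>d \<in> x\<close> generate the least filter above \<open>x\<close> and \<open>y\<close>. If it
  is proper, it extends to a prime filter, a common upper bound of \<open>x\<close> and \<open>y\<close>.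
\<close>

lemma up_disjoint_iff:
  assumes x: "prime_filter x" and y: "prime_filter y"
  shows "up y \<inter> up x = {} \<longleftrightarrow> (\<exists>c\<in>y. \<exists>d\<in>x. inf c d = bot)"
proof
  assume "\<exists>c\<in>y. \<exists>d\<in>x. inf c d = bot"
  then obtain c d where "c \<in> y" "d \<in> x" "inf c d = bot" by blast
  then show "up y \<inter> up x = {}"
    using prime_filter_inf_iff[of _ c d] prime_filter_bot by (auto simp: up_def)
next
  assume disj: "up y \<inter> up x = {}"
  show "\<exists>c\<in>y. \<exists>d\<in>x. inf c d = bot"
  proof (rule ccontr)
    assume none: "\<not> (\<exists>c\<in>y. \<exists>d\<in>x. inf c d = bot)"
    let ?F = "{g. \<exists>c\<in>y. \<exists>d\<in>x. inf c d \<le> g}"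
    have "inf g h \<in> ?F" if gh: "g \<in> ?F" "h \<in> ?F" for g h
    proof -
      obtain c d c' d' where "c \<in> y" "d \<in> x" "c' \<in> y" "d' \<in> x" "inf c d \<le> g" "inf c' d' \<le> h"
        using gh by blast
      then have "inf c c' \<in> y" "inf d d' \<in> x" "inf (inf c c') (inf d d') \<le> inf g h"
        using prime_filter_inf_iff[OF x] prime_filter_inf_iff[OF y]
        by (auto intro: order_trans[OF inf_mono[OF inf_le1 inf_le1]]
            order_trans[OF inf_mono[OF inf_le2 inf_le2]])
      then show ?thesis by blast
    qed
    moreover have gen: "y \<subseteq> ?F" "x \<subseteq> ?F"
      using prime_filter_top[OF x] prime_filter_top[OF y] by (force intro: inf_le1 inf_le2)+
    ultimately have "lattice_filter ?F"
      using prime_filter_top[OF x] unfolding lattice_filter_def by (blast intro: order_trans)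
    moreover have "?F \<inter> {..bot} = {}"
      using none by (auto simp: bot_unique)
    ultimately obtain z where "prime_filter z" "?F \<subseteq> z" "z \<inter> {..bot} = {}"
      by (rule disjoint_prime_filter_exists[OF _ lattice_ideal_principal])
    then have "z \<in> up y \<inter> up x"
      using order_trans[OF gen(1)] order_trans[OF gen(2)] unfolding up_def by blast
    with disj show False
      by simp
  qed
qed

section \<open>Density of the subfit Hausdorff points\<close>

lemma subfit_point:
  fixes e b :: "'a::frame"
  assumes "subfit TYPE('a)" "\<not> e \<le> b"
  obtains x where "prime_filter x" "b \<notin> x" "down x \<subseteq> sigma e"
proof -
  obtain c where c: "sup e c = top" "sup b c \<noteq> top"
    using assms unfolding subfit_def by blast
  then have "\<not> top \<le> sup b c"
    by (simp add: top_unique)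
  then obtain x where x: "prime_filter x" "sup b c \<notin> x"
    by (rule prime_filter_separates)
  then have "b \<notin> x" "c \<notin> x"
    by (simp_all add: prime_filter_sup_iff)
  with x(1) c(1) show thesis
    by (intro that[of x]) (auto simp: down_subset_sigma_iff)
qed

text \<open>
  This moves the witness \<open>pseudocomplement c\<close> of the Hausdorff condition below \<open>a\<close> and \<open>f\<close>: the
  condition is applied to \<open>a\<close> and \<open>inf a f \<rightarrow> b\<close>, since \<open>s \<le> (inf a f \<rightarrow> b)\<close> says
  \<open>inf (inf a f) s \<le> b\<close>, which for \<open>s = a\<close> is just \<open>inf a f \<le> b\<close>.
\<close>

lemma hausdorff_frame_localized:
  fixes a b f :: "'a::frame"
  assumes "hausdorff_frame TYPE('a)" "a \<noteq> top" "\<not> inf a f \<le> b"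
  obtains c where "\<not> c \<le> a" "\<not> inf (inf a f) (pseudocomplement c) \<le> b"
proof -
  obtain h where h: "\<And>s. s \<le> h \<longleftrightarrow> inf (inf a f) s \<le> b"
    using relative_pseudocomplement_exists[of "inf a f" b] by blast
  have "inf (inf a f) a = inf a f"
    by (simp add: inf.absorb1)
  then have "\<not> a \<le> h"
    using assms(3) h by simp
  then show thesis
    using assms(1,2) h that unfolding hausdorff_frame_def by metis
qed

text \<open>
  Subfitness produces the point \<open>x\<close> in \<open>sigma (pseudocomplement c)\<close>, and \<open>\<not> c \<le> a\<close> produces the maximal
  point \<open>y\<close> outside \<open>sigma a\<close>; they are separated because \<open>c \<in> y\<close>.
\<close>

lemma haus_sfit_point:
  fixes a f j :: "'a::frame"
  assumes sf: "subfit TYPE('a)" and hf: "hausdorff_frame TYPE('a)" and "\<not> inf a f \<le> j"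
  obtains x where "x \<in> haus_sfit (sigma a)" "f \<in> x" "j \<notin> x"
proof (cases "a = top")
  case True
  with assms(3) have "\<not> f \<le> j" by simp
  then obtain x where "prime_filter x" "f \<in> x" "j \<notin> x"
    by (rule prime_filter_separates)
  then show thesis
    using True sigma_eq_prime_filters_iff[of a]
    by (intro that[of x]) (auto simp: haus_sfit_def down_def)
next
  case False
  obtain c where c: "\<not> c \<le> a" "\<not> inf (inf a f) (pseudocomplement c) \<le> j"
    using hausdorff_frame_localized[OF hf False assms(3)] .
  obtain x where x: "prime_filter x" "j \<notin> x"
    "down x \<subseteq> sigma (inf (inf a f) (pseudocomplement c))"
    using subfit_point[OF sf c(2)] .
  obtain y where y: "prime_filter y" "c \<in> y" "y \<in> max_points (prime_filters - sigma a)"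
    using prime_filter_separates[OF c(1)] .
  have "x \<in> down x"
    using x(1) by (simp add: down_def)
  with x(3) have in_x: "a \<in> x" "f \<in> x" "pseudocomplement c \<in> x"
    using x(1) by (auto simp: sigma_def prime_filter_inf_iff)
  have "down x \<subseteq> sigma a"
    using x(3) by (auto simp: sigma_def prime_filter_inf_iff)
  moreover have "up y \<inter> up x = {}"
    using up_disjoint_iff[OF x(1) y(1)] y(2) in_x(3) le_pseudocomplement_iff by blast
  ultimately have "x \<in> haus_sfit (sigma a)"
    using x(1) in_x(1) y(3) by (auto simp: haus_sfit_def sigma_def)
  with in_x(2) x(2) show thesis
    by (intro that)
qed

lemma closure_haus_sfit_sigma:
  fixes a :: "'a::frame"
  assumes "subfit TYPE('a)" "hausdorff_frame TYPE('a)"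
  shows "priestley_space closure_of (haus_sfit (sigma a)) = sigma a"
proof
  have "closedin priestley_space (sigma a)"
    using clopen_upset_sigma[of a] by (simp add: clopen_upset_def)
  then show "priestley_space closure_of (haus_sfit (sigma a)) \<subseteq> sigma a"
    by (rule closure_of_minimal[rotated]) (auto simp: haus_sfit_def)
next
  show "sigma a \<subseteq> priestley_space closure_of (haus_sfit (sigma a))"
  proof
    fix x assume "x \<in> sigma a"
    then have x: "prime_filter x" "a \<in> x"
      by (auto simp: sigma_def)
    have "\<exists>z\<in>haus_sfit (sigma a). prime_filter z \<and> f \<in> z \<and> j \<notin> z" if "f \<in> x" "j \<notin> x" for f j
    proof -
      have "\<not> inf a f \<le> j"
        using that x prime_filter_inf_iff prime_filter_mono by metis
      then obtain z where "z \<in> haus_sfit (sigma a)" "f \<in> z" "j \<notin> z"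
        using haus_sfit_point assms by metis
      then show ?thesis
        by (auto simp: haus_sfit_def sigma_def)
    qed
    with x(1) show "x \<in> priestley_space closure_of (haus_sfit (sigma a))"
      unfolding in_closure_of_priestley_iff by blast
  qed
qed

lemma haus_sfit_point_of_closure:
  fixes a b :: "'a::frame"
  assumes "priestley_space closure_of (haus_sfit (sigma a)) = sigma a" "\<not> a \<le> b"
  obtains x where "x \<in> haus_sfit (sigma a)" "prime_filter x" "b \<notin> x"
proof -
  obtain y where y: "prime_filter y" "a \<in> y" "b \<notin> y"
    using prime_filter_separates[OF assms(2)] .
  then have "y \<in> priestley_space closure_of (haus_sfit (sigma a))"
    using assms(1) by (simp add: sigma_def)
  with y show thesis
    using that unfolding in_closure_of_priestley_iff by blast
qed

lemma subfit_of_closure_haus_sfit: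
  assumes "\<And>a :: 'a::frame. priestley_space closure_of (haus_sfit (sigma a)) = sigma a"
  shows "subfit TYPE('a)"
  unfolding subfit_def
proof (intro allI impI)
  fix a b :: 'a assume "\<not> a \<le> b"
  then obtain x where x: "x \<in> haus_sfit (sigma a)" "prime_filter x" "b \<notin> x"
    using haus_sfit_point_of_closure assms by metis
  then obtain c where "c \<notin> x" "sup a c = top"
    using down_subset_sigma_iff[OF x(2), of a] unfolding haus_sfit_def by blast
  moreover from this have "sup b c \<noteq> top"
    using x prime_filter_sup_iff prime_filter_top by metis
  ultimately show "\<exists>c. sup a c = top \<and> sup b c \<noteq> top"
    by blast
qed

lemma hausdorff_frame_of_closure_haus_sfit:
  assumes "\<And>a :: 'a::frame. priestley_space closure_of (haus_sfit (sigma a)) = sigma a"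
  shows "hausdorff_frame TYPE('a)"
  unfolding hausdorff_frame_def
proof (intro allI impI)
  fix a b :: 'a assume ab: "a \<noteq> top \<and> \<not> a \<le> b"
  then obtain x where x: "x \<in> haus_sfit (sigma a)" "prime_filter x" "b \<notin> x"
    using haus_sfit_point_of_closure assms by metis
  obtain y where y: "y \<in> max_points (prime_filters - sigma a)" "up y \<inter> up x = {}"
    using x(1) ab sigma_eq_prime_filters_iff[of a] by (auto simp: haus_sfit_def)
  then have yp: "prime_filter y" "a \<notin> y"
    by (auto simp: max_points_def sigma_def)
  obtain c d where c: "c \<in> y" "d \<in> x" "inf c d = bot"
    using y(2) up_disjoint_iff[OF x(2) yp(1)] by blast
  have "\<not> c \<le> a"
    using c(1) yp prime_filter_mono by blast
  moreover have "pseudocomplement c \<in> x"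
    using c x(2) le_pseudocomplement_iff prime_filter_mono by blast
  then have "\<not> pseudocomplement c \<le> b"
    using x prime_filter_mono by blast
  ultimately show "\<exists>c. \<not> c \<le> a \<and> \<not> pseudocomplement c \<le> b"
    by blast
qed

theorem theorem5p12:
  shows "subfit TYPE('a::frame) \<and> hausdorff_frame TYPE('a) \<longleftrightarrow>
    (\<forall>U :: 'a set set. clopen_upset U \<longrightarrow> priestley_space closure_of (haus_sfit U) = U)"
proof (intro iffI allI impI)
  fix U :: "'a set set"
  assume L: "subfit TYPE('a) \<and> hausdorff_frame TYPE('a)" and "clopen_upset U"
  from \<open>clopen_upset U\<close> obtain a where "U = sigma a"
    by (rule clopen_upset_eq_sigma)
  with L show "priestley_space closure_of (haus_sfit U) = U"
    by (simp add: closure_haus_sfit_sigma)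
next
  assume "\<forall>U :: 'a set set. clopen_upset U \<longrightarrow> priestley_space closure_of (haus_sfit U) = U"
  then have "priestley_space closure_of (haus_sfit (sigma a)) = sigma a" for a :: 'a
    using clopen_upset_sigma by blast
  then show "subfit TYPE('a) \<and> hausdorff_frame TYPE('a)"
    using subfit_of_closure_haus_sfit hausdorff_frame_of_closure_haus_sfit by blast
qed

end
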